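(* Let $A$ be an anti-commutative algebra (not necessarily associative). Then the following are equivalent: (1) $A$ is a dextral symmetric algebra; (2) $A$ is anti-associative; (3) $A$ is a CB-algebra.
   Context: An algebra means a module $A$ over a commutative ring with unity (for example a vector space over a field) with a bilinear product $(x,y)\mapsto xy$, not assumed associative or unital. $A$ is anti-commutative if $x^2=0$ for all $x\in A$ (hence $xy=-yx$ for all $x,y\in A$). $A$ is anti-associative if $x(yz)=-(xy)z$ for all $x,y,z\in A$. $A$ is dextral symmetric if for all $a,b,c\in A$, $a(bc)=0$ implies $b(ac)=0$. $A$ is a CB-algebra if, whenever $x,y\in A$ satisfy $xy=0$, one has $(xz)y=0$ for all $z\in A$. *)

theory Defs
  imports "HOL-Algebra.Module"
begin

(* HOL-Algebra's locale "algebra" demands an associative, commutative and unital product.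
   Here only bilinearity of the product is required. The record type for modules extends
   the one for rings, so the multiplication of A is its field mult; nothing is assumed
   about its field one. *)
locale nonassoc_algebra = module R A for R (structure) and A (structure) +
  assumes mult_closed:
      "\<lbrakk>x \<in> carrier A; y \<in> carrier A\<rbrakk> \<Longrightarrow> x \<otimes>\<^bsub>A\<^esub> y \<in> carrier A"
    and mult_add_left:
      "\<lbrakk>x \<in> carrier A; y \<in> carrier A; z \<in> carrier A\<rbrakk> \<Longrightarrow>
        (x \<oplus>\<^bsub>A\<^esub> y) \<otimes>\<^bsub>A\<^esub> z = x \<otimes>\<^bsub>A\<^esub> z \<oplus>\<^bsub>A\<^esub> y \<otimes>\<^bsub>A\<^esub> z"
    and mult_add_right:
      "\<lbrakk>x \<in> carrier A; y \<in> carrier A; z \<in> carrier A\<rbrakk> \<Longrightarrow>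
        x \<otimes>\<^bsub>A\<^esub> (y \<oplus>\<^bsub>A\<^esub> z) = x \<otimes>\<^bsub>A\<^esub> y \<oplus>\<^bsub>A\<^esub> x \<otimes>\<^bsub>A\<^esub> z"
    and mult_smult_left:
      "\<lbrakk>r \<in> carrier R; x \<in> carrier A; y \<in> carrier A\<rbrakk> \<Longrightarrow>
        (r \<odot>\<^bsub>A\<^esub> x) \<otimes>\<^bsub>A\<^esub> y = r \<odot>\<^bsub>A\<^esub> (x \<otimes>\<^bsub>A\<^esub> y)"
    and mult_smult_right:
      "\<lbrakk>r \<in> carrier R; x \<in> carrier A; y \<in> carrier A\<rbrakk> \<Longrightarrow>
        x \<otimes>\<^bsub>A\<^esub> (r \<odot>\<^bsub>A\<^esub> y) = r \<odot>\<^bsub>A\<^esub> (x \<otimes>\<^bsub>A\<^esub> y)"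

definition anti_commutative :: "('a, 'm) ring_scheme \<Rightarrow> bool" where
  "anti_commutative A \<longleftrightarrow> (\<forall>x\<in>carrier A. x \<otimes>\<^bsub>A\<^esub> x = \<zero>\<^bsub>A\<^esub>)"

definition anti_associative :: "('a, 'm) ring_scheme \<Rightarrow> bool" where
  "anti_associative A \<longleftrightarrow>
    (\<forall>x\<in>carrier A. \<forall>y\<in>carrier A. \<forall>z\<in>carrier A.
      x \<otimes>\<^bsub>A\<^esub> (y \<otimes>\<^bsub>A\<^esub> z) = \<ominus>\<^bsub>A\<^esub> ((x \<otimes>\<^bsub>A\<^esub> y) \<otimes>\<^bsub>A\<^esub> z))"

definition dextral_symmetric :: "('a, 'm) ring_scheme \<Rightarrow> bool" where
  "dextral_symmetric A \<longleftrightarrow>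
    (\<forall>a\<in>carrier A. \<forall>b\<in>carrier A. \<forall>c\<in>carrier A.
      a \<otimes>\<^bsub>A\<^esub> (b \<otimes>\<^bsub>A\<^esub> c) = \<zero>\<^bsub>A\<^esub> \<longrightarrow> b \<otimes>\<^bsub>A\<^esub> (a \<otimes>\<^bsub>A\<^esub> c) = \<zero>\<^bsub>A\<^esub>)"

definition CB_algebra :: "('a, 'm) ring_scheme \<Rightarrow> bool" where
  "CB_algebra A \<longleftrightarrow>
    (\<forall>x\<in>carrier A. \<forall>y\<in>carrier A. x \<otimes>\<^bsub>A\<^esub> y = \<zero>\<^bsub>A\<^esub> \<longrightarrow>
      (\<forall>z\<in>carrier A. (x \<otimes>\<^bsub>A\<^esub> z) \<otimes>\<^bsub>A\<^esub> y = \<zero>\<^bsub>A\<^esub>))"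

end

theory Submission
  imports Defs
begin

text \<open>In an anti-commutative algebra, both dextral symmetry and the CB property, specialised to two
  equal elements, yield the identity \<open>x (y x) = 0\<close>. Linearising it in \<open>x\<close> shows that the trilinear map
  \<open>x (y z)\<close> changes sign under exchange of \<open>x\<close> and \<open>z\<close>; since it also changes sign under exchange of
  \<open>y\<close> and \<open>z\<close>, it is invariant under cyclic permutations, and
  \<open>x (y z) = z (x y) = - (x y) z\<close>.\<close>

context nonassoc_algebra
begin

text \<open>The zero vector is the scalar zero times \<open>x\<close>; by homogeneity this scalar
  moves out of the product and annihilates it.\<close>

lemma mult_zero_right:
  assumes "x \<in> carrier A"
  shows "x \<otimes>\<^bsub>A\<^esub> \<zero>\<^bsub>A\<^esub> = \<zero>\<^bsub>A\<^esub>"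
  using mult_smult_right[of "\<zero>\<^bsub>R\<^esub>" x x] assms by (simp add: mult_closed)

lemma mult_minus_right:
  assumes "x \<in> carrier A" "y \<in> carrier A"
  shows "x \<otimes>\<^bsub>A\<^esub> (\<ominus>\<^bsub>A\<^esub> y) = \<ominus>\<^bsub>A\<^esub> (x \<otimes>\<^bsub>A\<^esub> y)"
proof -
  have "x \<otimes>\<^bsub>A\<^esub> (\<ominus>\<^bsub>A\<^esub> y) \<oplus>\<^bsub>A\<^esub> x \<otimes>\<^bsub>A\<^esub> y = \<zero>\<^bsub>A\<^esub>"
    using assms by (simp add: mult_add_right[symmetric] M.l_neg mult_zero_right)
  then show ?thesis
    using assms M.minus_equality by (simp add: mult_closed)
qed

text \<open>Polarisation of \<open>x x = 0\<close>: once \<open>x + y\<close> is squared and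
  expanded, only the two mixed products survive.\<close>

lemma anti_commutativeD:
  assumes "anti_commutative A" "x \<in> carrier A" "y \<in> carrier A"
  shows "x \<otimes>\<^bsub>A\<^esub> y = \<ominus>\<^bsub>A\<^esub> (y \<otimes>\<^bsub>A\<^esub> x)"
proof -
  have sq: "z \<otimes>\<^bsub>A\<^esub> z = \<zero>\<^bsub>A\<^esub>" if "z \<in> carrier A" for z
    using assms(1) that by (simp add: anti_commutative_def)
  have "(x \<oplus>\<^bsub>A\<^esub> y) \<otimes>\<^bsub>A\<^esub> (x \<oplus>\<^bsub>A\<^esub> y) = x \<otimes>\<^bsub>A\<^esub> y \<oplus>\<^bsub>A\<^esub> y \<otimes>\<^bsub>A\<^esub> x"
    \<comment> \<open>Only two instances of \<open>sq\<close> are supplied: the general rule also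
      matches the whole left-hand side, which is to be expanded here.\<close>
    using assms(2,3) by (simp add: mult_add_left mult_add_right mult_closed sq[of x] sq[of y] M.a_comm)
  then have "x \<otimes>\<^bsub>A\<^esub> y \<oplus>\<^bsub>A\<^esub> y \<otimes>\<^bsub>A\<^esub> x = \<zero>\<^bsub>A\<^esub>"
    using assms(2,3) by (simp add: sq)
  then show ?thesis
    using assms(2,3) M.minus_equality by (simp add: mult_closed)
qed

lemma mult_minus_left:
  assumes "anti_commutative A" "x \<in> carrier A" "y \<in> carrier A"
  shows "(\<ominus>\<^bsub>A\<^esub> x) \<otimes>\<^bsub>A\<^esub> y = \<ominus>\<^bsub>A\<^esub> (x \<otimes>\<^bsub>A\<^esub> y)"
  using anti_commutativeD[OF assms(1), of "\<ominus>\<^bsub>A\<^esub> x" y] anti_commutativeD[OF assms(1), of x y] assms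
  by (simp add: mult_minus_right)

text \<open>Shared last stage of the two implications that end in anti-associativity: dextral
  symmetry and the CB property each enter only through \<open>flex\<close>.\<close>

lemma anti_associative_if_mult_mult_self_eq_zero:
  assumes ac: "anti_commutative A"
    and flex: "\<And>x y. \<lbrakk>x \<in> carrier A; y \<in> carrier A\<rbrakk> \<Longrightarrow> x \<otimes>\<^bsub>A\<^esub> (y \<otimes>\<^bsub>A\<^esub> x) = \<zero>\<^bsub>A\<^esub>"
  shows "anti_associative A"
proof -
  have swap: "x \<otimes>\<^bsub>A\<^esub> (y \<otimes>\<^bsub>A\<^esub> z) = \<ominus>\<^bsub>A\<^esub> (z \<otimes>\<^bsub>A\<^esub> (y \<otimes>\<^bsub>A\<^esub> x))"
    if [simp]: "x \<in> carrier A" "y \<in> carrier A" "z \<in> carrier A" for x y z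
  proof -
    have "(x \<oplus>\<^bsub>A\<^esub> z) \<otimes>\<^bsub>A\<^esub> (y \<otimes>\<^bsub>A\<^esub> (x \<oplus>\<^bsub>A\<^esub> z))
        = x \<otimes>\<^bsub>A\<^esub> (y \<otimes>\<^bsub>A\<^esub> z) \<oplus>\<^bsub>A\<^esub> z \<otimes>\<^bsub>A\<^esub> (y \<otimes>\<^bsub>A\<^esub> x)"
      \<comment> \<open>The instances of \<open>flex\<close> at \<open>x\<close> and
        \<open>z\<close> remove the diagonal terms and leave the unexpanded product
        untouched.\<close>
      by (simp add: mult_add_left mult_add_right mult_closed flex[of x] flex[of z] M.a_comm)
    then have "x \<otimes>\<^bsub>A\<^esub> (y \<otimes>\<^bsub>A\<^esub> z) \<oplus>\<^bsub>A\<^esub> z \<otimes>\<^bsub>A\<^esub> (y \<otimes>\<^bsub>A\<^esub> x) = \<zero>\<^bsub>A\<^esub>"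
      by (simp add: flex)
    then show ?thesis
      using M.minus_equality by (simp add: mult_closed)
  qed
  have "x \<otimes>\<^bsub>A\<^esub> (y \<otimes>\<^bsub>A\<^esub> z) = \<ominus>\<^bsub>A\<^esub> ((x \<otimes>\<^bsub>A\<^esub> y) \<otimes>\<^bsub>A\<^esub> z)"
    if [simp]: "x \<in> carrier A" "y \<in> carrier A" "z \<in> carrier A" for x y z
  proof -
    have "x \<otimes>\<^bsub>A\<^esub> (y \<otimes>\<^bsub>A\<^esub> z) = \<ominus>\<^bsub>A\<^esub> (z \<otimes>\<^bsub>A\<^esub> (y \<otimes>\<^bsub>A\<^esub> x))"
      by (simp add: swap[of x])
    also have "\<dots> = z \<otimes>\<^bsub>A\<^esub> (x \<otimes>\<^bsub>A\<^esub> y)"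
      by (simp add: anti_commutativeD[OF ac, of y x] mult_minus_right mult_closed)
    also have "\<dots> = \<ominus>\<^bsub>A\<^esub> ((x \<otimes>\<^bsub>A\<^esub> y) \<otimes>\<^bsub>A\<^esub> z)"
      by (simp add: anti_commutativeD[OF ac, of z] mult_closed)
    finally show ?thesis .
  qed
  then show ?thesis
    by (simp add: anti_associative_def)
qed

text \<open>Reassociate, exchange \<open>x\<close> and \<open>y\<close> inside the bracket,
  reassociate back: three changes of sign. Thus left multiplications anticommute, which carries the
  vanishing of one product over to another.\<close>

lemma mult_left_swap:
  assumes ac: "anti_commutative A" and "anti_associative A"
    and [simp]: "x \<in> carrier A" "y \<in> carrier A" "z \<in> carrier A"
  shows "x \<otimes>\<^bsub>A\<^esub> (y \<otimes>\<^bsub>A\<^esub> z) = \<ominus>\<^bsub>A\<^esub> (y \<otimes>\<^bsub>A\<^esub> (x \<otimes>\<^bsub>A\<^esub> z))"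
proof -
  have "x \<otimes>\<^bsub>A\<^esub> (y \<otimes>\<^bsub>A\<^esub> z) = \<ominus>\<^bsub>A\<^esub> ((x \<otimes>\<^bsub>A\<^esub> y) \<otimes>\<^bsub>A\<^esub> z)"
    using assms by (simp add: anti_associative_def)
  also have "\<dots> = (y \<otimes>\<^bsub>A\<^esub> x) \<otimes>\<^bsub>A\<^esub> z"
    by (simp add: anti_commutativeD[OF ac, of x y] mult_minus_left[OF ac] mult_closed)
  also have "\<dots> = \<ominus>\<^bsub>A\<^esub> (y \<otimes>\<^bsub>A\<^esub> (x \<otimes>\<^bsub>A\<^esub> z))"
    using assms by (simp add: anti_associative_def mult_closed)
  finally show ?thesis .
qed

lemma dextral_symmetric_iff_anti_associative:
  assumes ac: "anti_commutative A"
  shows "dextral_symmetric A \<longleftrightarrow> anti_associative A"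
proof
  assume ds: "dextral_symmetric A"
  have "x \<otimes>\<^bsub>A\<^esub> (y \<otimes>\<^bsub>A\<^esub> x) = \<zero>\<^bsub>A\<^esub>" if "x \<in> carrier A" "y \<in> carrier A" for x y
  proof -
    \<comment> \<open>Dextral symmetry is applied with \<open>a = y\<close> and
      \<open>b = c = x\<close>, where its premise reduces to \<open>x x = 0\<close>.\<close>
    have "y \<otimes>\<^bsub>A\<^esub> (x \<otimes>\<^bsub>A\<^esub> x) = \<zero>\<^bsub>A\<^esub>"
      using ac that by (simp add: anti_commutative_def mult_zero_right)
    then show ?thesis
      using ds that by (simp add: dextral_symmetric_def)
  qed
  then show "anti_associative A"
    by (rule anti_associative_if_mult_mult_self_eq_zero[OF ac])
next
  assume "anti_associative A"
  then have "y \<otimes>\<^bsub>A\<^esub> (x \<otimes>\<^bsub>A\<^esub> z) = \<zero>\<^bsub>A\<^esub>"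
    if "x \<in> carrier A" "y \<in> carrier A" "z \<in> carrier A" "x \<otimes>\<^bsub>A\<^esub> (y \<otimes>\<^bsub>A\<^esub> z) = \<zero>\<^bsub>A\<^esub>" for x y z
    using mult_left_swap[OF ac, of y x z] that by simp
  then show "dextral_symmetric A"
    by (simp add: dextral_symmetric_def)
qed

lemma anti_associative_iff_CB_algebra:
  assumes ac: "anti_commutative A"
  shows "anti_associative A \<longleftrightarrow> CB_algebra A"
proof
  assume aa: "anti_associative A"
  have "(x \<otimes>\<^bsub>A\<^esub> z) \<otimes>\<^bsub>A\<^esub> y = \<zero>\<^bsub>A\<^esub>"
    if [simp]: "x \<in> carrier A" "y \<in> carrier A" "z \<in> carrier A" and xy: "x \<otimes>\<^bsub>A\<^esub> y = \<zero>\<^bsub>A\<^esub>" for x y z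
  proof -
    \<comment> \<open>Moving \<open>z\<close> to the front exposes the inner factor
      \<open>x y\<close>, which vanishes by \<open>xy\<close>.\<close>
    have "x \<otimes>\<^bsub>A\<^esub> (z \<otimes>\<^bsub>A\<^esub> y) = \<zero>\<^bsub>A\<^esub>"
      by (simp add: mult_left_swap[OF ac aa, of x] xy mult_zero_right)
    moreover have "(x \<otimes>\<^bsub>A\<^esub> z) \<otimes>\<^bsub>A\<^esub> y = \<ominus>\<^bsub>A\<^esub> (x \<otimes>\<^bsub>A\<^esub> (z \<otimes>\<^bsub>A\<^esub> y))"
      using aa by (simp add: anti_associative_def mult_closed)
    ultimately show ?thesis
      by simp
  qed
  then show "CB_algebra A"
    by (simp add: CB_algebra_def)
next
  assume cb: "CB_algebra A"
  have "x \<otimes>\<^bsub>A\<^esub> (y \<otimes>\<^bsub>A\<^esub> x) = \<zero>\<^bsub>A\<^esub>" if "x \<in> carrier A" "y \<in> carrier A" for x y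
  proof -
    \<comment> \<open>The CB property is used for the pair \<open>x\<close>, \<open>x\<close>, whose
      product is zero. Exchanging the factors of the inner and then of the outer product turns the
      result into the form of \<open>flex\<close>.\<close>
    have "(x \<otimes>\<^bsub>A\<^esub> y) \<otimes>\<^bsub>A\<^esub> x = \<zero>\<^bsub>A\<^esub>"
      using ac cb that by (simp add: anti_commutative_def CB_algebra_def)
    then have "(y \<otimes>\<^bsub>A\<^esub> x) \<otimes>\<^bsub>A\<^esub> x = \<zero>\<^bsub>A\<^esub>"
      using that by (simp add: anti_commutativeD[OF ac, of y x] mult_minus_left[OF ac] mult_closed)
    then show ?thesis
      using anti_commutativeD[OF ac, of x "y \<otimes>\<^bsub>A\<^esub> x"] that by (simp add: mult_closed)
  qed
  then show "anti_associative A"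
    by (rule anti_associative_if_mult_mult_self_eq_zero[OF ac])
qed

end

theorem proposition2p7:
  fixes R :: "('r, 'n) ring_scheme" and A :: "('r, 'a, 'm) module_scheme"
  assumes "nonassoc_algebra R A"
    and "anti_commutative A"
  shows "(dextral_symmetric A \<longleftrightarrow> anti_associative A)
    \<and> (anti_associative A \<longleftrightarrow> CB_algebra A)"
  using nonassoc_algebra.dextral_symmetric_iff_anti_associative[OF assms]
    nonassoc_algebra.anti_associative_iff_CB_algebra[OF assms] by blast

end
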